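(* $330\leq\mathrm{A}_2(7,4)\leq407$.
   Context: $\mathrm{A}_2(7,4)$ is the maximum size of a set of subspaces (of arbitrary dimensions) of $\mathbb{F}_2^7$ with pairwise subspace distance $\mathrm{d}_{\mathrm{S}}(X,Y)=\dim(X+Y)-\dim(X\cap Y)\geq4$. *)

theory Defs
  imports "HOL-Analysis.Analysis" "HOL-Library.Z2"
begin

text \<open>The ambient space F_2^7 is the type bit^7 (bit = the field with two
elements from HOL-Library.Z2); subspaces and dimensions are those of the
library interpretation vec of vector_space with scalar multiplication (*s).\<close>

definition subspace_sum :: "('a::field ^ 'n) set \<Rightarrow> ('a ^ 'n) set \<Rightarrow> ('a ^ 'n) set" where
  "subspace_sum X Y = {x + y | x y. x \<in> X \<and> y \<in> Y}"

definition subspace_dist :: "('a::field ^ 'n) set \<Rightarrow> ('a ^ 'n) set \<Rightarrow> nat" where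
  "subspace_dist X Y = vec.dim (subspace_sum X Y) - vec.dim (X \<inter> Y)"

definition subspace_code_F2_7 :: "nat \<Rightarrow> (bit ^ 7) set set \<Rightarrow> bool" where
  "subspace_code_F2_7 d C \<longleftrightarrow>
     (\<forall>U\<in>C. vec.subspace U) \<and>
     (\<forall>X\<in>C. \<forall>Y\<in>C. X \<noteq> Y \<longrightarrow> subspace_dist X Y \<ge> d)"

definition A2_7 :: "nat \<Rightarrow> nat" where
  "A2_7 d = Max {card C | C. subspace_code_F2_7 d C}"

end

theory Submission
  imports Defs
begin

text \<open>
  Upper bound: at most one codeword has dimension at most 1, and at most one has dimension at
  least 6. For the others we use the semidefinite programming bound. The kernels
  \<open>kernel1\<close> and \<open>kernel2\<close> are Gram matrices, obtained by projecting the indicator functions of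
  X on points and of X \<times> X on independent pairs of points to the isotypic components of degree
  1 and 2 of the permutation module. A combination K of them and of the constant
  kernel, with positive semidefinite coefficients indexed by the dimensions, satisfies
  K(X, Y) \<le> -138 for distinct codewords and K(X, X) \<le> 55420, so a code of size n has
  0 \<le> 55420 n - 138 n (n - 1), that is n \<le> 402.

  Lower bound: 330 planes (3-dimensional subspaces) with pairwise intersections of dimension at
  most 1, equivalently such that no line is contained in two of them.
\<close>

section \<open>Subspaces over the field with two elements\<close>


lemma UNIV_bit: "UNIV = {0, 1 :: bit}"
  using bit.exhaust by auto

lemma ex_bit: "(\<exists>k :: bit. P k) \<longleftrightarrow> P 0 \<or> P 1"
  by (metis bit.exhaust)

instance bit :: finite
  by standard (simp add: UNIV_bit)

text \<open>The only scalars are 0 and 1, so adjoining \<open>v\<close> adds just one translate of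
  the span.\<close>

lemma span_insert_bit:
  fixes B :: "(bit ^ 'n) set"
  shows "vec.span (insert v B) = vec.span B \<union> (+) v ` vec.span B"
proof -
  have "x \<in> vec.span (insert v B) \<longleftrightarrow> x \<in> vec.span B \<or> x \<in> (+) v ` vec.span B" for x
  proof -
    have "x \<in> vec.span (insert v B) \<longleftrightarrow> (\<exists>k. x - k *s v \<in> vec.span B)"
      by (simp add: vec.span_breakdown_eq)
    also have "\<dots> \<longleftrightarrow> x \<in> vec.span B \<or> x - v \<in> vec.span B"
      by (simp add: ex_bit)
    also have "x - v \<in> vec.span B \<longleftrightarrow> x \<in> (+) v ` vec.span B"
      by (auto simp: image_iff intro: bexI[of _ "x - v"])
    finally show ?thesis .
  qed
  then show ?thesis by blast
qed

text \<open>Each further independent vector adds a disjoint translate of the span, which doubles its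
  size.\<close>

lemma card_span_bit:
  fixes B :: "(bit ^ 'n) set"
  assumes "finite B" "vec.independent B"
  shows "card (vec.span B) = 2 ^ card B"
  using assms
proof (induction B rule: finite_induct)
  case empty
  then show ?case by simp
next
  case (insert v B)
  have ind: "vec.independent B" and v: "v \<notin> vec.span B"
    using insert by (simp_all add: vec.independent_insert)
  have "v + w \<notin> vec.span B" if "w \<in> vec.span B" for w
    using v that by (metis add_diff_cancel_right' vec.span_diff)
  then have "vec.span B \<inter> (+) v ` vec.span B = {}" by blast
  then show ?case
    using insert.IH[OF ind] insert.hyps
    by (simp add: span_insert_bit card_Un_disjoint card_image)
qed

lemma card_subspace_bit:
  fixes X :: "(bit ^ 'n) set"
  assumes "vec.subspace X"
  shows "card X = 2 ^ vec.dim X"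
proof -
  obtain B where B: "B \<subseteq> X" "vec.independent B" "X \<subseteq> vec.span B" "card B = vec.dim X"
    using vec.basis_exists by blast
  have "vec.span B = X"
    using B assms by (metis vec.span_subspace)
  then show ?thesis
    using card_span_bit[OF vec.finiteI_independent[OF B(2)] B(2)] B(4) by simp
qed

section \<open>Two positive semidefinite kernels\<close>

text \<open>Exchanging the sums turns the form into a sum of squares, one for each
  \<open>p\<close>.\<close>

lemma gram_nonneg:
  fixes g :: "'a \<Rightarrow> real" and f :: "'a \<Rightarrow> 'b \<Rightarrow> real"
  shows "0 \<le> (\<Sum>X\<in>C. \<Sum>Y\<in>C. g X * g Y * (\<Sum>p\<in>P. f X p * f Y p))"
proof -
  have "(\<Sum>X\<in>C. \<Sum>Y\<in>C. g X * g Y * (\<Sum>p\<in>P. f X p * f Y p))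
      = (\<Sum>X\<in>C. \<Sum>Y\<in>C. \<Sum>p\<in>P. (g X * f X p) * (g Y * f Y p))"
    by (simp add: sum_distrib_left mult_ac)
  also have "\<dots> = (\<Sum>X\<in>C. \<Sum>p\<in>P. \<Sum>Y\<in>C. (g X * f X p) * (g Y * f Y p))"
    by (rule sum.cong[OF refl], rule sum.swap)
  also have "\<dots> = (\<Sum>p\<in>P. \<Sum>X\<in>C. \<Sum>Y\<in>C. (g X * f X p) * (g Y * f Y p))"
    by (rule sum.swap)
  also have "\<dots> = (\<Sum>p\<in>P. (\<Sum>X\<in>C. g X * f X p)\<^sup>2)"
    by (simp add: sum_product power2_eq_square)
  finally show ?thesis by (simp add: sum_nonneg)
qed

section \<open>Characteristic two and sums over nonzero vectors\<close>

lemma add_self_bit [simp]: "x + x = (0 :: bit ^ 'n)"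
  by (simp add: vec_eq_iff)

lemma add_left_cancel_bit [simp]: "x + (x + y) = (y :: bit ^ 'n)"
  by (simp add: add.assoc[symmetric])

lemma add_eq_0_iff_bit [simp]: "x + y = 0 \<longleftrightarrow> x = (y :: bit ^ 'n)"
  by (metis add_left_cancel_bit add.right_neutral add_self_bit)

lemma card_bit7: "CARD(bit ^ 7) = 128"
proof -
  have "CARD(bit) = 2" by (simp add: UNIV_bit)
  then show ?thesis by simp
qed

context
  fixes X :: "(bit ^ 7) set"
  assumes X: "vec.subspace X"
begin

lemma zero_mem: "0 \<in> X"
  using X by (rule vec.subspace_0)

lemma add_mem_iff: "x \<in> X \<Longrightarrow> x + y \<in> X \<longleftrightarrow> y \<in> X"
  using X vec.subspace_add by (metis add_left_cancel_bit)

lemma sum_nonzero: "(\<Sum>v\<in>UNIV - {0}. of_bool (v \<in> X)) = real (card X) - 1"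
proof -
  have "(UNIV - {0}) \<inter> {v. v \<in> X} = X - {0}" by auto
  moreover have "0 < card X" using zero_mem by (auto simp: card_gt_0_iff)
  ultimately show ?thesis
    using zero_mem by (simp add: sum_of_bool_eq card_Diff_singleton Suc_le_eq of_nat_diff)
qed

lemma sum_pair:
  assumes "x \<noteq> 0"
  shows "(\<Sum>y\<in>UNIV - {0, x}. of_bool (y \<in> X)) = real (card X) - 1 - of_bool (x \<in> X)"
proof -
  have "(\<Sum>v\<in>UNIV - {0}. of_bool (v \<in> X) :: real)
      = of_bool (x \<in> X) + (\<Sum>y\<in>UNIV - {0} - {x}. of_bool (y \<in> X))"
    using assms by (intro sum.remove) auto
  moreover have "UNIV - {0} - {x} = UNIV - {0, x}" by auto
  ultimately show ?thesis using sum_nonzero by simp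
qed

end

text \<open>Adding \<open>x\<close> is an involution that exchanges \<open>0\<close> and
  \<open>x\<close>, hence permutes the remaining vectors.\<close>

lemma sum_shift:
  fixes h :: "bit ^ 7 \<Rightarrow> real"
  shows "(\<Sum>y\<in>UNIV - {0, x}. h (x + y)) = (\<Sum>y\<in>UNIV - {0, x}. h y)"
  by (rule sum.reindex_bij_witness[of _ "(+) x" "(+) x"]) auto

lemma sum_centered_product:
  fixes p q :: "'a \<Rightarrow> real"
  shows "(\<Sum>v\<in>A. (p v - c) * (q v - d))
    = (\<Sum>v\<in>A. p v * q v) - d * (\<Sum>v\<in>A. p v) - c * (\<Sum>v\<in>A. q v) + real (card A) * (c * d)"
  by (simp add: algebra_simps sum.distrib sum_subtractf sum_distrib_left)

section \<open>The kernel of degree 1\<close>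

definition kernel1 :: "(bit ^ 7) set \<Rightarrow> (bit ^ 7) set \<Rightarrow> real" where
  "kernel1 X Y = (real (card (X \<inter> Y)) - 1) - (real (card X) - 1) * (real (card Y) - 1) / 127"

text \<open>\<open>kernel1 X Y\<close> is the inner product of the indicator functions on the 127
  nonzero vectors, each centered by subtracting its mean.\<close>

lemma kernel1_nonneg:
  assumes "\<And>X. X \<in> C \<Longrightarrow> vec.subspace X"
  shows "0 \<le> (\<Sum>X\<in>C. \<Sum>Y\<in>C. g X * g Y * kernel1 X Y)"
proof -
  define f :: "(bit ^ 7) set \<Rightarrow> bit ^ 7 \<Rightarrow> real"
    where "f X v = of_bool (v \<in> X) - (real (card X) - 1) / 127" for X v
  have "kernel1 X Y = (\<Sum>v\<in>UNIV - {0}. f X v * f Y v)" if XY: "X \<in> C" "Y \<in> C" for X Y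
  proof -
    have s: "vec.subspace X" "vec.subspace Y" "vec.subspace (X \<inter> Y)"
      using assms XY by (auto intro: vec.subspace_inter)
    have "(\<Sum>v\<in>UNIV - {0}. of_bool (v \<in> X) * of_bool (v \<in> Y)) = real (card (X \<inter> Y)) - 1"
      using sum_nonzero[OF s(3)] by (simp only: Int_iff of_bool_conj)
    moreover have "card (UNIV - {0 :: bit ^ 7}) = 127"
      by (simp add: card_Diff_singleton card_bit7 del: CARD_vec)
    ultimately show ?thesis
      unfolding f_def sum_centered_product kernel1_def sum_nonzero[OF s(1)] sum_nonzero[OF s(2)]
      by (simp add: field_simps)
  qed
  then have "(\<Sum>X\<in>C. \<Sum>Y\<in>C. g X * g Y * kernel1 X Y)
      = (\<Sum>X\<in>C. \<Sum>Y\<in>C. g X * g Y * (\<Sum>v\<in>UNIV - {0}. f X v * f Y v))"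
    by simp
  also have "\<dots> \<ge> 0" by (rule gram_nonneg)
  finally show ?thesis .
qed

section \<open>The kernel of degree 2\<close>

text \<open>The coefficients make this function orthogonal to all functions of x, of y, or of x + y
  alone (\<open>pair_fun_orthogonal\<close>).\<close>

definition pair_fun :: "(bit ^ 7) set \<Rightarrow> bit ^ 7 \<Rightarrow> bit ^ 7 \<Rightarrow> real" where
  "pair_fun X x y = of_bool (x \<in> X) * of_bool (y \<in> X) - (real (card X) - 2) / 124 *
     (of_bool (x \<in> X) + of_bool (y \<in> X) + of_bool (x + y \<in> X) - (real (card X) - 1) / 63)"

abbreviation indep_pairs :: "((bit ^ 7) \<times> (bit ^ 7)) set" where
  "indep_pairs \<equiv> SIGMA x:UNIV - {0}. UNIV - {0, x}"

text \<open>Closed form of the inner product of \<open>pair_fun X\<close> and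
  \<open>pair_fun Y\<close> over \<open>indep_pairs\<close>; the leading product counts the ordered
  independent pairs inside the intersection.\<close>

definition kernel2 :: "(bit ^ 7) set \<Rightarrow> (bit ^ 7) set \<Rightarrow> real" where
  "kernel2 X Y = (real (card (X \<inter> Y)) - 1) * (real (card (X \<inter> Y)) - 2)
     - (real (card X) - 2) * (real (card Y) - 2) / 124 *
       (3 * (real (card (X \<inter> Y)) - 1) - (real (card X) - 1) * (real (card Y) - 1) / 63)"

lemma pair_fun_swap: "pair_fun X y x = pair_fun X x y"
  by (simp add: pair_fun_def add_ac)

text \<open>Together with \<open>pair_fun_swap\<close> this gives invariance under all permutations
  of \<open>x\<close>, \<open>y\<close>, \<open>x + y\<close>.\<close>

lemma pair_fun_shift:
  assumes "vec.subspace X"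
  shows "pair_fun X (x + y) y = pair_fun X x y"
proof -
  have "x + y + y = x" by (simp add: add.assoc)
  moreover have "x + y \<in> X \<and> y \<in> X \<longleftrightarrow> x \<in> X \<and> y \<in> X"
    using add_mem_iff[OF assms, of y x] by (auto simp: add.commute)
  then have "of_bool (x + y \<in> X) * of_bool (y \<in> X) = (of_bool (x \<in> X) * of_bool (y \<in> X) :: real)"
    by (simp only: of_bool_conj[symmetric])
  ultimately show ?thesis by (simp add: pair_fun_def add_ac)
qed

text \<open>This explains the constants of \<open>pair_fun\<close>: there are 126 vectors
  \<open>y\<close>, cancellation for \<open>x\<close> outside \<open>X\<close> leads to
  \<open>63 = 126 / 2\<close>, and for \<open>x\<close> in \<open>X\<close> it then leads to
  \<open>124 = 126 - 2\<close>.\<close>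

lemma pair_fun_row:
  assumes X: "vec.subspace X" and "x \<noteq> 0"
  shows "(\<Sum>y\<in>UNIV - {0, x}. pair_fun X x y) = 0"
proof -
  let ?R = "UNIV - {0, x}"
  have "card ?R = 126"
    using \<open>x \<noteq> 0\<close> by (simp add: card_Diff_subset card_bit7 del: CARD_vec)
  then have "(\<Sum>y\<in>?R. p * q y - m * (p + q y + r y - c)) = p * (\<Sum>y\<in>?R. q y)
      - m * (126 * p + (\<Sum>y\<in>?R. q y) + (\<Sum>y\<in>?R. r y) - 126 * c)" for p m c :: real and q r
    by (simp add: sum.distrib sum_subtractf sum_distrib_left[symmetric])
  then have "(\<Sum>y\<in>?R. pair_fun X x y) = of_bool (x \<in> X) * (\<Sum>y\<in>?R. of_bool (y \<in> X))
      - (real (card X) - 2) / 124 * (126 * of_bool (x \<in> X) + (\<Sum>y\<in>?R. of_bool (y \<in> X))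
        + (\<Sum>y\<in>?R. of_bool (x + y \<in> X)) - 126 * ((real (card X) - 1) / 63))"
    unfolding pair_fun_def .
  also have "(\<Sum>y\<in>?R. of_bool (x + y \<in> X)) = (\<Sum>y\<in>?R. of_bool (y \<in> X) :: real)"
    by (rule sum_shift)
  finally show ?thesis
    unfolding sum_pair[OF X \<open>x \<noteq> 0\<close>] by (cases "x \<in> X") (simp_all add: field_simps)
qed

text \<open>The first sum vanishes row by row; the symmetries of \<open>pair_fun\<close> carry the
  other two to it.\<close>

lemma pair_fun_orthogonal:
  assumes X: "vec.subspace X"
  shows "(\<Sum>(x, y)\<in>indep_pairs. pair_fun X x y * h x) = 0"
    and "(\<Sum>(x, y)\<in>indep_pairs. pair_fun X x y * h y) = 0"
    and "(\<Sum>(x, y)\<in>indep_pairs. pair_fun X x y * h (x + y)) = 0"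
proof -
  show 1: "(\<Sum>(x, y)\<in>indep_pairs. pair_fun X x y * h x) = 0"
    by (simp add: sum.Sigma[symmetric] sum_distrib_right[symmetric] pair_fun_row[OF X])
  have "(\<Sum>(x, y)\<in>indep_pairs. pair_fun X x y * h y) = (\<Sum>(x, y)\<in>indep_pairs. pair_fun X x y * h x)"
    by (rule sum.reindex_bij_witness[of _ "\<lambda>(x, y). (y, x)" "\<lambda>(x, y). (y, x)"])
       (auto simp: pair_fun_swap)
  with 1 show "(\<Sum>(x, y)\<in>indep_pairs. pair_fun X x y * h y) = 0" by simp
  have "x + y + y = x" for x y :: "bit ^ 7" by (simp add: add.assoc)
  then have "(\<Sum>(x, y)\<in>indep_pairs. pair_fun X x y * h (x + y)) = (\<Sum>(x, y)\<in>indep_pairs. pair_fun X x y * h x)"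
    by (intro sum.reindex_bij_witness[of _ "\<lambda>(x, y). (x + y, y)" "\<lambda>(x, y). (x + y, y)"])
       (auto simp: pair_fun_shift[OF X])
  with 1 show "(\<Sum>(x, y)\<in>indep_pairs. pair_fun X x y * h (x + y)) = 0" by simp
qed

lemma kernel2_eq:
  assumes X: "vec.subspace X" and Y: "vec.subspace Y"
  shows "(\<Sum>(x, y)\<in>indep_pairs. pair_fun X x y * pair_fun Y x y) = kernel2 X Y"
proof -
  define a b t :: real
    where "a = real (card X)" and "b = real (card Y)" and "t = real (card (X \<inter> Y))"
  define m where "m = (b - 2) / 124"
  have XY: "vec.subspace (X \<inter> Y)" using X Y by (rule vec.subspace_inter)
  have split: "pair_fun X x y * pair_fun Y x y = pair_fun X x y * (of_bool (x \<in> Y) * of_bool (y \<in> Y))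
      - pair_fun X x y * (m * of_bool (x \<in> Y)) - pair_fun X x y * (m * of_bool (y \<in> Y))
      - pair_fun X x y * (m * of_bool (x + y \<in> Y)) + pair_fun X x y * (m * ((b - 1) / 63))" for x y
  proof -
    have "P * (u - m * (p + q + r - c)) = P * u - P * (m * p) - P * (m * q) - P * (m * r) + P * (m * c)"
      for P u p q r c :: real
      by (simp add: algebra_simps)
    then show ?thesis unfolding pair_fun_def[of Y] m_def b_def .
  qed
  \<comment> \<open>Of the factor \<open>pair_fun Y\<close> only the product of indicators survives:
    its other terms depend on one of \<open>x\<close>, \<open>y\<close>, \<open>x + y\<close> or are
    constant, hence are orthogonal to \<open>pair_fun X\<close>.\<close>
  have "(\<Sum>(x, y)\<in>indep_pairs. pair_fun X x y * pair_fun Y x y)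
      = (\<Sum>(x, y)\<in>indep_pairs. pair_fun X x y * (of_bool (x \<in> Y) * of_bool (y \<in> Y)))"
    unfolding split
    using pair_fun_orthogonal(1)[OF X, of "\<lambda>x. m * of_bool (x \<in> Y)"]
      pair_fun_orthogonal(2)[OF X, of "\<lambda>x. m * of_bool (x \<in> Y)"]
      pair_fun_orthogonal(3)[OF X, of "\<lambda>x. m * of_bool (x \<in> Y)"]
      pair_fun_orthogonal(1)[OF X, of "\<lambda>x. m * ((b - 1) / 63)"]
    by (simp add: case_prod_unfold sum.distrib sum_subtractf)
  also have "\<dots> = (\<Sum>x\<in>UNIV - {0}. \<Sum>y\<in>UNIV - {0, x}. pair_fun X x y * (of_bool (x \<in> Y) * of_bool (y \<in> Y)))"
    by (rule sum.Sigma[symmetric]) auto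
  also have "\<dots> = (\<Sum>x\<in>UNIV - {0}. of_bool (x \<in> Y) *
      (\<Sum>y\<in>UNIV - {0, x}. of_bool (y \<in> Y) * pair_fun X x y))"
    by (simp only: sum_distrib_left mult_ac)
  \<comment> \<open>Here \<open>b - 4\<close> is \<open>(b - 2) + 2 * (t - 2) - 2 * (t - 1)\<close>,
    the change of the bracket when \<open>x\<close> moves from outside \<open>X\<close> into
    \<open>X\<close>.\<close>
  also have "\<dots> = (\<Sum>x\<in>UNIV - {0}. of_bool (x \<in> X \<inter> Y) * ((t - 2) - (a - 2) / 124 * (b - 4))
      - of_bool (x \<in> Y) * ((a - 2) / 124 * (2 * (t - 1) - (a - 1) / 63 * (b - 2))))"
  proof (rule sum.cong[OF refl])
    fix x :: "bit ^ 7"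
    assume "x \<in> UNIV - {0}"
    then have "x \<noteq> 0" by simp
    let ?R = "UNIV - {0, x}"
    have "(\<Sum>y\<in>?R. of_bool (y \<in> Y) * pair_fun X x y)
        = of_bool (x \<in> X) * ((t - 2) - (a - 2) / 124 * (b - 4))
          - (a - 2) / 124 * (2 * (t - 1) - (a - 1) / 63 * (b - 2))" if "x \<in> Y"
    proof -
      have sY: "(\<Sum>y\<in>?R. of_bool (y \<in> Y)) = b - 2"
        using sum_pair[OF Y \<open>x \<noteq> 0\<close>] that by (simp add: b_def)
      have sXY: "(\<Sum>y\<in>?R. of_bool (y \<in> Y) * of_bool (y \<in> X)) = t - 1 - of_bool (x \<in> X)"
        using sum_pair[OF XY \<open>x \<noteq> 0\<close>] that
        by (simp only: Int_iff of_bool_conj t_def mult.commute) simp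
      \<comment> \<open>Since \<open>x\<close> is in \<open>Y\<close>, passing from \<open>y\<close>
        to \<open>x + y\<close> preserves membership in \<open>Y\<close>, so the shift reduces this
        sum to \<open>sXY\<close>.\<close>
      have "(\<Sum>y\<in>?R. of_bool (y \<in> Y) * of_bool (x + y \<in> X) :: real)
          = (\<Sum>y\<in>?R. of_bool (x + y \<in> Y) * of_bool (x + y \<in> X))"
        using add_mem_iff[OF Y that] by simp
      also have "\<dots> = t - 1 - of_bool (x \<in> X)"
        using sum_shift[of "\<lambda>y. of_bool (y \<in> Y) * of_bool (y \<in> X)" x] sXY by simp
      finally have sXY': "(\<Sum>y\<in>?R. of_bool (y \<in> Y) * of_bool (x + y \<in> X)) = t - 1 - of_bool (x \<in> X)" .
      have "of_bool (y \<in> Y) * pair_fun X x y = of_bool (x \<in> X) * (of_bool (y \<in> Y) * of_bool (y \<in> X))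
          - (a - 2) / 124 * (of_bool (x \<in> X) * of_bool (y \<in> Y) + of_bool (y \<in> Y) * of_bool (y \<in> X)
            + of_bool (y \<in> Y) * of_bool (x + y \<in> X) - (a - 1) / 63 * of_bool (y \<in> Y))" for y
      proof -
        have "u * (p * q - m * (p + q + r - c)) = p * (u * q) - m * (p * u + u * q + u * r - c * u)"
          for u p q r m c :: real
          by (simp add: algebra_simps)
        then show ?thesis unfolding pair_fun_def a_def .
      qed
      then have "(\<Sum>y\<in>?R. of_bool (y \<in> Y) * pair_fun X x y)
          = of_bool (x \<in> X) * (\<Sum>y\<in>?R. of_bool (y \<in> Y) * of_bool (y \<in> X))
          - (a - 2) / 124 * (of_bool (x \<in> X) * (\<Sum>y\<in>?R. of_bool (y \<in> Y))
            + (\<Sum>y\<in>?R. of_bool (y \<in> Y) * of_bool (y \<in> X))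
            + (\<Sum>y\<in>?R. of_bool (y \<in> Y) * of_bool (x + y \<in> X))
            - (a - 1) / 63 * (\<Sum>y\<in>?R. of_bool (y \<in> Y)))"
        by (simp only: sum.distrib sum_subtractf sum_distrib_left[symmetric])
      then show ?thesis
        unfolding sY sXY sXY'
        by (cases "x \<in> X") (simp_all add: algebra_simps add_divide_distrib diff_divide_distrib)
    qed
    then show "of_bool (x \<in> Y) * (\<Sum>y\<in>?R. of_bool (y \<in> Y) * pair_fun X x y)
        = of_bool (x \<in> X \<inter> Y) * ((t - 2) - (a - 2) / 124 * (b - 4))
          - of_bool (x \<in> Y) * ((a - 2) / 124 * (2 * (t - 1) - (a - 1) / 63 * (b - 2)))"
      by (cases "x \<in> Y")
        (simp_all only: Int_iff simp_thms of_bool_eq mult_1 mult_zero_left diff_self)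
  qed
  also have "\<dots> = (t - 1) * ((t - 2) - (a - 2) / 124 * (b - 4))
      - (b - 1) * ((a - 2) / 124 * (2 * (t - 1) - (a - 1) / 63 * (b - 2)))"
    unfolding sum_subtractf sum_distrib_right[symmetric] sum_nonzero[OF XY] sum_nonzero[OF Y]
      t_def[symmetric] b_def[symmetric] ..
  also have "\<dots> = kernel2 X Y"
    unfolding kernel2_def a_def[symmetric] b_def[symmetric] t_def[symmetric]
    by (simp add: algebra_simps add_divide_distrib diff_divide_distrib)
  finally show ?thesis .
qed

lemma kernel2_nonneg:
  assumes "\<And>X. X \<in> C \<Longrightarrow> vec.subspace X"
  shows "0 \<le> (\<Sum>X\<in>C. \<Sum>Y\<in>C. g X * g Y * kernel2 X Y)"
proof -
  have "(\<Sum>X\<in>C. \<Sum>Y\<in>C. g X * g Y * kernel2 X Y) = (\<Sum>X\<in>C. \<Sum>Y\<in>C. g X * g Y *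
      (\<Sum>p\<in>indep_pairs. (case p of (x, y) \<Rightarrow> pair_fun X x y) * (case p of (x, y) \<Rightarrow> pair_fun Y x y)))"
    using assms by (simp add: kernel2_eq[symmetric] case_prod_unfold)
  also have "\<dots> \<ge> 0" by (rule gram_nonneg)
  finally show ?thesis .
qed


section \<open>The upper bound\<close>

text \<open>The entries of a weight list belong to the dimensions 2, 3, 4, 5. The integers are a rounded
  rank-5 dual solution of the semidefinite program, found numerically.\<close>

definition weight :: "real list \<Rightarrow> (bit ^ 7) set \<Rightarrow> real" where
  "weight ws X = ws ! (vec.dim X - 2)"

text \<open>Every coefficient matrix is a sum of outer products of weight lists, hence visibly
  positive semidefinite: one product for the constant kernel, two for each other kernel.\<close>

definition code_kernel :: "(bit ^ 7) set \<Rightarrow> (bit ^ 7) set \<Rightarrow> real" where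
  "code_kernel X Y =
     weight [-14, -2, 2, 14] X * weight [-14, -2, 2, 14] Y
     + (weight [72, 31, 13, 5] X * weight [72, 31, 13, 5] Y
        + weight [1, 14, 20, 25] X * weight [1, 14, 20, 25] Y) * kernel1 X Y
     + (weight [79, 19, 18, 5] X * weight [79, 19, 18, 5] Y
        + weight [3, 31, -2, 9] X * weight [3, 31, -2, 9] Y) * kernel2 X Y"

lemma sum_code_kernel_nonneg:
  assumes "\<And>X. X \<in> C \<Longrightarrow> vec.subspace X"
  shows "0 \<le> (\<Sum>X\<in>C. \<Sum>Y\<in>C. code_kernel X Y)"
proof -
  have "0 \<le> (\<Sum>X\<in>C. weight ws X)\<^sup>2" for ws by simp
  then have "0 \<le> (\<Sum>X\<in>C. \<Sum>Y\<in>C. weight ws X * weight ws Y)" for ws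
    by (simp add: power2_eq_square sum_product)
  moreover have "(\<Sum>X\<in>C. \<Sum>Y\<in>C. code_kernel X Y)
      = (\<Sum>X\<in>C. \<Sum>Y\<in>C. weight [-14, -2, 2, 14] X * weight [-14, -2, 2, 14] Y)
      + (\<Sum>X\<in>C. \<Sum>Y\<in>C. weight [72, 31, 13, 5] X * weight [72, 31, 13, 5] Y * kernel1 X Y)
      + (\<Sum>X\<in>C. \<Sum>Y\<in>C. weight [1, 14, 20, 25] X * weight [1, 14, 20, 25] Y * kernel1 X Y)
      + (\<Sum>X\<in>C. \<Sum>Y\<in>C. weight [79, 19, 18, 5] X * weight [79, 19, 18, 5] Y * kernel2 X Y)
      + (\<Sum>X\<in>C. \<Sum>Y\<in>C. weight [3, 31, -2, 9] X * weight [3, 31, -2, 9] Y * kernel2 X Y)"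
    by (simp only: code_kernel_def ring_distribs sum.distrib add.assoc)
  ultimately show ?thesis
    using kernel1_nonneg[OF assms] kernel2_nonneg[OF assms] by (simp only: add_nonneg_nonneg)
qed

section \<open>Kernel values and the bound for dimensions 2 to 5\<close>

lemma dim_sum_Int:
  fixes X Y :: "(bit ^ 7) set"
  assumes "vec.subspace X" "vec.subspace Y"
  shows "vec.dim (subspace_sum X Y) + vec.dim (X \<inter> Y) = vec.dim X + vec.dim Y"
  using vec.dim_sums_Int[OF assms] by (simp add: subspace_sum_def)

lemma dim_le_7: "vec.dim (X :: (bit ^ 7) set) \<le> 7"
  using vec.dim_subset_UNIV[of X] by (simp add: vec.dimension_def card_cart_basis)

lemma code_kernel_distinct:
  assumes X: "vec.subspace X" "vec.dim X \<in> {2..5}" and Y: "vec.subspace Y" "vec.dim Y \<in> {2..5}"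
    and dist: "subspace_dist X Y \<ge> 4"
  shows "code_kernel X Y \<le> - 138"
proof -
  define a b d where "a = vec.dim X" and "b = vec.dim Y" and "d = vec.dim (X \<inter> Y)"
  have XY: "vec.subspace (X \<inter> Y)" using X(1) Y(1) by (rule vec.subspace_inter)
  have card: "card X = 2 ^ a" "card Y = 2 ^ b" "card (X \<inter> Y) = 2 ^ d"
    using card_subspace_bit X(1) Y(1) XY by (simp_all add: a_def b_def d_def)
  \<comment> \<open>The sum has dimension at most 7, and the distance is
    \<open>a + b - 2 * d\<close>. This leaves finitely many triples of dimensions, each settled by
    arithmetic.\<close>
  have bounds: "a + b \<le> 7 + d" "4 + 2 * d \<le> a + b"
    using dim_sum_Int[OF X(1) Y(1)] dim_le_7[of "subspace_sum X Y"] dist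
    by (simp_all add: subspace_dist_def a_def b_def d_def)
  have "a = 2 \<or> a = 3 \<or> a = 4 \<or> a = 5" "b = 2 \<or> b = 3 \<or> b = 4 \<or> b = 5"
    using X(2) Y(2) by (auto simp: a_def b_def)
  moreover from this bounds have "d = 0 \<or> d = 1 \<or> d = 2 \<or> d = 3" by linarith
  ultimately show ?thesis
    using bounds
    unfolding code_kernel_def kernel1_def kernel2_def weight_def card
      a_def[symmetric] b_def[symmetric]
    by (elim disjE) simp_all
qed

lemma code_kernel_diagonal:
  assumes X: "vec.subspace X" "vec.dim X \<in> {2..5}"
  shows "code_kernel X X \<le> 55420"
proof -
  have "vec.dim X = 2 \<or> vec.dim X = 3 \<or> vec.dim X = 4 \<or> vec.dim X = 5"
    using X(2) by auto
  then show ?thesis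
    unfolding code_kernel_def kernel1_def kernel2_def weight_def
    using card_subspace_bit[OF X(1)] by (elim disjE) simp_all
qed

lemma card_code_dim_2_5:
  assumes C: "subspace_code_F2_7 4 C" and dim: "\<And>X. X \<in> C \<Longrightarrow> vec.dim X \<in> {2..5}"
  shows "card C \<le> 402"
proof (rule ccontr)
  assume "\<not> card C \<le> 402"
  then have n: "403 \<le> real (card C)" by simp
  have sub: "vec.subspace X" if "X \<in> C" for X
    using C that by (simp add: subspace_code_F2_7_def)
  \<comment> \<open>With \<open>55558 = 55420 + 138\<close> one expression covers both cases; 403 is
    the least \<open>n\<close> with \<open>138 * n > 55558\<close>.\<close>
  have "code_kernel X Y \<le> (if X = Y then 55558 else 0) - 138" if "X \<in> C" "Y \<in> C" for X Y
  proof (cases "X = Y")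
    case True
    then show ?thesis using code_kernel_diagonal[OF sub dim] that by simp
  next
    case False
    then have "subspace_dist X Y \<ge> 4" using C that by (simp add: subspace_code_F2_7_def)
    then show ?thesis
      using code_kernel_distinct[OF sub dim sub dim] that False by simp
  qed
  then have "(\<Sum>X\<in>C. \<Sum>Y\<in>C. code_kernel X Y)
      \<le> (\<Sum>X\<in>C. \<Sum>Y\<in>C. (if X = Y then 55558 else 0) - 138)"
    by (intro sum_mono)
  also have "\<dots> = real (card C) * (55558 - 138 * real (card C))"
    by (simp add: sum_subtractf algebra_simps)
  also have "\<dots> < 0"
    using n by (intro mult_pos_neg) simp_all
  finally show False using sum_code_kernel_nonneg[of C] sub by simp
qed

section \<open>Codewords of extreme dimension\<close>

lemma card_le_1_if_dist_le_2:
  assumes C: "subspace_code_F2_7 4 C" and "D \<subseteq> C"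
    and "\<And>X Y. X \<in> D \<Longrightarrow> Y \<in> D \<Longrightarrow> subspace_dist X Y \<le> 2"
  shows "card D \<le> 1"
proof -
  have "X = Y" if "X \<in> D" "Y \<in> D" for X Y
  proof (rule ccontr)
    assume "X \<noteq> Y"
    then have "subspace_dist X Y \<ge> 4" using C subsetD[OF assms(2)] that
      by (simp add: subspace_code_F2_7_def)
    with assms(3)[OF that] show False by simp
  qed
  then show ?thesis using card_le_Suc0_iff_eq[of D] by simp
qed

text \<open>Two subspaces of dimension at most 1 are at distance at most \<open>1 + 1\<close>, two
  of dimension at least 6 at distance at most \<open>2 * 7 - 6 - 6\<close>. Hence the total
  \<open>1 + 402 + 1\<close>.\<close>

lemma card_code_le:
  assumes C: "subspace_code_F2_7 4 C"
  shows "card C \<le> 404"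
proof -
  have sub: "vec.subspace X" if "X \<in> C" for X
    using C that by (simp add: subspace_code_F2_7_def)
  let ?L = "{X \<in> C. vec.dim X < 2}" and ?M = "{X \<in> C. vec.dim X \<in> {2..5}}"
    and ?H = "{X \<in> C. vec.dim X > 5}"
  have "subspace_dist X Y \<le> 2" if "X \<in> ?L" "Y \<in> ?L" for X Y
  proof -
    have "vec.dim X < 2" "vec.dim Y < 2" using that by auto
    then show ?thesis
      using dim_sum_Int[of X Y] sub that unfolding subspace_dist_def by fastforce
  qed
  then have L: "card ?L \<le> 1" by (intro card_le_1_if_dist_le_2[OF C]) auto
  have "subspace_dist X Y \<le> 2" if "X \<in> ?H" "Y \<in> ?H" for X Y
  proof -
    have "vec.dim X > 5" "vec.dim Y > 5" using that by auto
    then show ?thesis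
      using dim_sum_Int[of X Y] dim_le_7[of "subspace_sum X Y"] sub that
      unfolding subspace_dist_def by fastforce
  qed
  then have H: "card ?H \<le> 1" by (intro card_le_1_if_dist_le_2[OF C]) auto
  have "subspace_code_F2_7 4 ?M" using C by (auto simp: subspace_code_F2_7_def)
  then have M: "card ?M \<le> 402" by (rule card_code_dim_2_5) simp
  have "C = ?L \<union> (?M \<union> ?H)" by auto
  then have "card C \<le> card ?L + (card ?M + card ?H)"
    by (metis (no_types, lifting) add_le_cancel_left card_Un_le le_trans)
  with L M H show ?thesis by simp
qed


section \<open>A code of 330 planes\<close>

definition coord :: "7 \<Rightarrow> nat" where
  "coord = (SOME h. bij_betw h UNIV {..<7})"

lemma bij_coord: "bij_betw coord UNIV {..<7}"
proof -
  have "\<exists>h. bij_betw h (UNIV :: 7 set) {0..<card (UNIV :: 7 set)}"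
    by (rule ex_bij_betw_finite_nat) simp
  then have "\<exists>h. bij_betw h (UNIV :: 7 set) {..<7 :: nat}"
    by (simp add: atLeast0LessThan)
  then show ?thesis unfolding coord_def by (rule someI_ex)
qed

text \<open>Addition becomes \<open>xor\<close> of integers below 128, which makes the incidence
  check executable. Any numbering \<open>coord\<close> serves, as only linear relations
  matter.\<close>

definition vec_of :: "int \<Rightarrow> bit ^ 7" where
  "vec_of x = (\<chi> i. of_bool (bit x (coord i)))"

lemma vec_of_0 [simp]: "vec_of 0 = 0"
  by (simp add: vec_of_def vec_eq_iff)

lemma vec_of_xor: "vec_of (xor x y) = vec_of x + vec_of y"
  by (auto simp: vec_of_def vec_eq_iff bit_xor_iff)

lemma inj_vec_of: "inj_on vec_of {0..<128}"
proof (rule inj_onI)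
  fix x y :: int
  assume xy: "x \<in> {0..<128}" "y \<in> {0..<128}" and eq: "vec_of x = vec_of y"
  have "bit x n \<longleftrightarrow> bit y n" if "n < 7" for n
  proof -
    have "n \<in> range coord" using bij_coord that by (simp add: bij_betw_def)
    then obtain i where "coord i = n" by blast
    moreover have "vec_of x $ i = vec_of y $ i"
      using eq by simp
    ultimately show ?thesis
      by (cases "bit x n"; cases "bit y n") (simp_all add: vec_of_def)
  qed
  then have "take_bit 7 x = take_bit 7 y"
    by (auto simp: bit_eq_iff bit_take_bit_iff)
  then show "x = y"
    using xy by (simp add: take_bit_int_eq_self)
qed

section \<open>Planes, their points and their lines\<close>

fun plane_points :: "int \<times> int \<times> int \<Rightarrow> int list" where
  "plane_points (a, b, c) = [a, b, xor a b, c, xor a c, xor b c, xor a (xor b c)]"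

fun plane :: "int \<times> int \<times> int \<Rightarrow> (bit ^ 7) set" where
  "plane (a, b, c) = vec.span {vec_of a, vec_of b, vec_of c}"

text \<open>Three uses of \<open>span_insert_bit\<close> list the eight combinations of the
  generators. That they are distinct is checked later for the listed planes.\<close>

lemma plane_eq: "plane t = vec_of ` set (0 # plane_points t)"
proof (cases t)
  case (fields a b c)
  let ?A = "vec_of a" and ?B = "vec_of b" and ?C = "vec_of c"
  have "plane t = {0, ?C, ?B, ?B + ?C, ?A, ?A + ?C, ?A + ?B, ?A + (?B + ?C)}"
    by (simp only: fields plane.simps span_insert_bit vec.span_empty image_Un image_insert
        image_empty add.right_neutral Un_insert_left Un_empty_left insert_commute)
  also have "\<dots> = vec_of ` set (0 # plane_points t)"
    by (simp only: fields plane_points.simps list.set image_insert image_empty vec_of_xor vec_of_0)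
      blast
  finally show ?thesis .
qed

lemma subspace_plane: "vec.subspace (plane t)"
  by (cases t) simp

lemma xor_left_cancel: "xor x (xor x y) = (y :: int)"
  by (simp add: xor.assoc[symmetric])

lemma xor_eq_0: "xor x y = 0 \<longleftrightarrow> x = (y :: int)"
  by (metis xor_left_cancel xor.right_neutral xor_self_eq)

lemma plane_points_xor:
  assumes "p \<in> set (plane_points t)" "q \<in> set (plane_points t)" "p \<noteq> q"
  shows "xor p q \<in> set (plane_points t)"
proof (cases t)
  case (fields a b c)
  have "p = a \<or> p = b \<or> p = xor a b \<or> p = c \<or> p = xor a c \<or> p = xor b c \<or> p = xor a (xor b c)"
    "q = a \<or> q = b \<or> q = xor a b \<or> q = c \<or> q = xor a c \<or> q = xor b c \<or> q = xor a (xor b c)"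
    using assms by (simp_all add: fields)
  \<comment> \<open>The alternative 0 absorbs equal combinations. The instances of commutativity
    sort the generators in the order \<open>a\<close>, \<open>b\<close>, \<open>c\<close>, so that
    equal ones meet and cancel.\<close>
  then have "xor p q = 0 \<or> xor p q \<in> set (plane_points t)"
    unfolding fields
    by (elim disjE; hypsubst; simp add: xor.assoc xor.left_commute[of b a] xor.left_commute[of c a] xor.left_commute[of c b] xor.commute[of b a] xor.commute[of c a] xor.commute[of c b] xor_left_cancel)
  then show ?thesis using assms(3) by (simp add: xor_eq_0)
qed

text \<open>For a point p of the plane t, \<open>lines_at p t\<close> lists the middle points of the lines of t that
  have p as their smallest point, so that each line is recorded exactly once.\<close>

definition lines_at :: "int \<Rightarrow> int \<times> int \<times> int \<Rightarrow> int list" where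
  "lines_at p t = (let ps = plane_points t in
     if p \<in> set ps then filter (\<lambda>q. p < q \<and> q < xor p q) ps else [])"

text \<open>Any two points of a line have the third as their \<open>xor\<close>, so sorting the
  three points gives the form recorded by \<open>lines_at\<close>.\<close>

lemma ordered_line:
  fixes p q :: int
  assumes "p \<noteq> q" "p \<noteq> 0" "q \<noteq> 0"
  obtains u v where "u < v" "v < xor u v" "{u, v} \<subseteq> {p, q, xor p q}"
proof -
  let ?r = "xor p q"
  have ne: "?r \<noteq> p" "?r \<noteq> q" and r: "xor q p = ?r" "xor p ?r = q" "xor ?r p = q" "xor q ?r = p" "xor ?r q = p"
    using assms by (metis xor.commute xor.right_neutral xor_left_cancel xor_self_eq)+
  then consider "p < q \<and> q < ?r" | "q < p \<and> p < ?r" | "p < ?r \<and> ?r < q" | "?r < p \<and> p < q"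
    | "q < ?r \<and> ?r < p" | "?r < q \<and> q < p"
    using assms(1) by linarith
  then show thesis
    by cases (use that r in auto)
qed

lemma disjoint_if_distinct_concat:
  assumes "distinct (concat (map f xs))" "x \<in> set xs" "y \<in> set xs" "x \<noteq> y"
  shows "set (f x) \<inter> set (f y) = {}"
  using assms by (induction xs) auto

text \<open>Generators of 330 of the 333 planes of a code that was found by local search among the codes
  invariant under a group of order 2.\<close>

definition code_planes :: "(int \<times> int \<times> int) list" where
  "code_planes = [
    (1, 2, 24), (1, 4, 56), (1, 8, 36), (1, 10, 52), (1, 12, 96), (1, 14, 38), (1, 16, 34),
    (1, 18, 68), (1, 20, 64), (1, 22, 70), (1, 28, 98), (1, 30, 100), (1, 32, 78), (1, 42, 94),
    (1, 46, 88), (1, 48, 76), (1, 54, 92), (1, 58, 72), (2, 5, 40), (2, 8, 33), (2, 9, 49),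
    (2, 12, 84), (2, 16, 100), (2, 17, 108), (2, 21, 96), (2, 28, 69), (2, 29, 64),
    (2, 36, 76), (2, 37, 72), (2, 44, 92), (2, 52, 85), (2, 53, 73), (2, 57, 80), (2, 60, 77),
    (2, 61, 68), (3, 4, 105), (3, 5, 88), (3, 8, 112), (3, 12, 117), (3, 13, 68), (3, 16, 41),
    (3, 17, 77), (3, 20, 32), (3, 21, 104), (3, 29, 33), (3, 37, 84), (3, 40, 72), (3, 44, 64),
    (3, 48, 85), (3, 49, 69), (3, 53, 81), (3, 56, 89), (3, 61, 65), (4, 8, 66), (4, 9, 19),
    (4, 10, 112), (4, 11, 99), (4, 16, 73), (4, 17, 42), (4, 24, 43), (4, 25, 40), (4, 27, 75),
    (4, 33, 65), (4, 34, 81), (4, 35, 90), (4, 41, 82), (4, 48, 91), (4, 50, 64), (4, 58, 88),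
    (5, 8, 114), (5, 9, 99), (5, 10, 80), (5, 11, 19), (5, 16, 33), (5, 17, 67), (5, 18, 34),
    (5, 25, 72), (5, 26, 107), (5, 27, 104), (5, 32, 89), (5, 35, 65), (5, 41, 73),
    (5, 43, 74), (5, 50, 66), (5, 51, 75), (5, 58, 83), (5, 59, 64), (6, 9, 98), (6, 10, 67),
    (6, 19, 74), (6, 24, 32), (6, 25, 34), (6, 26, 40), (6, 27, 96), (6, 33, 80), (6, 35, 64),
    (6, 43, 83), (7, 8, 18), (7, 9, 82), (7, 10, 17), (7, 11, 48), (7, 19, 99), (7, 25, 73),
    (7, 32, 65), (7, 33, 88), (7, 35, 81), (7, 41, 66), (7, 49, 83), (7, 50, 90), (7, 51, 72),
    (7, 56, 75), (7, 57, 89), (7, 58, 64), (8, 16, 97), (8, 17, 39), (8, 22, 98), (8, 23, 69),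
    (8, 32, 85), (8, 34, 65), (8, 38, 64), (8, 48, 84), (8, 49, 71), (8, 50, 87), (8, 51, 83),
    (8, 55, 80), (9, 16, 67), (9, 17, 64), (9, 18, 103), (9, 20, 38), (9, 21, 66), (9, 22, 32),
    (9, 33, 68), (9, 34, 80), (9, 35, 84), (9, 39, 71), (9, 52, 69), (9, 53, 65), (9, 55, 86),
    (10, 16, 38), (10, 18, 101), (10, 19, 97), (10, 20, 66), (10, 21, 102), (10, 23, 36),
    (10, 32, 71), (10, 34, 64), (10, 39, 81), (10, 48, 65), (10, 49, 68), (10, 50, 82),
    (10, 55, 83), (11, 16, 69), (11, 17, 65), (11, 18, 32), (11, 20, 98), (11, 21, 70),
    (11, 23, 101), (11, 33, 64), (11, 34, 87), (11, 35, 82), (11, 36, 68), (11, 37, 81),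
    (11, 38, 66), (12, 16, 103), (12, 17, 68), (12, 18, 64), (12, 19, 33), (12, 20, 34),
    (12, 21, 101), (12, 22, 39), (12, 32, 83), (12, 35, 71), (12, 36, 80), (12, 51, 65),
    (12, 53, 87), (13, 16, 65), (13, 18, 37), (13, 20, 103), (13, 32, 69), (13, 33, 87),
    (13, 34, 83), (13, 36, 70), (13, 38, 86), (13, 49, 85), (13, 50, 84), (13, 51, 80),
    (13, 53, 64), (13, 54, 66), (14, 16, 37), (14, 17, 99), (14, 18, 65), (14, 20, 97),
    (14, 21, 35), (14, 23, 102), (14, 34, 69), (14, 36, 87), (14, 48, 70), (14, 49, 81),
    (14, 50, 80), (14, 55, 64), (15, 16, 71), (15, 17, 96), (15, 19, 35), (15, 20, 37),
    (15, 22, 64), (15, 23, 68), (15, 32, 84), (15, 33, 82), (15, 34, 67), (15, 36, 66),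
    (15, 52, 81), (15, 54, 70), (15, 55, 69), (16, 32, 64), (16, 39, 68), (16, 40, 70),
    (16, 45, 79), (16, 46, 75), (16, 47, 66), (17, 32, 75), (17, 36, 69), (17, 37, 71),
    (17, 40, 66), (17, 41, 79), (17, 43, 76), (18, 35, 66), (18, 36, 72), (18, 38, 75),
    (18, 41, 74), (18, 42, 67), (18, 44, 71), (18, 46, 70), (19, 32, 66), (19, 34, 72),
    (19, 36, 65), (19, 37, 77), (19, 38, 79), (19, 39, 64), (19, 40, 71), (19, 46, 67),
    (19, 47, 73), (20, 33, 71), (20, 36, 74), (20, 39, 76), (20, 40, 69), (20, 43, 78),
    (20, 44, 68), (21, 34, 79), (21, 38, 71), (21, 39, 73), (21, 41, 78), (21, 43, 68),
    (21, 44, 72), (21, 47, 69), (22, 33, 72), (22, 34, 66), (22, 35, 78), (22, 36, 67),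
    (22, 37, 73), (22, 38, 69), (22, 40, 76), (22, 44, 77), (22, 45, 75), (22, 46, 65),
    (22, 47, 74), (23, 37, 76), (23, 38, 74), (23, 40, 73), (23, 41, 67), (23, 43, 64),
    (23, 44, 65), (23, 45, 78), (23, 47, 72), (24, 33, 76), (24, 35, 77), (24, 36, 71),
    (24, 39, 69), (24, 40, 79), (24, 41, 65), (24, 42, 78), (24, 44, 74), (24, 45, 70),
    (25, 33, 66), (25, 37, 75), (25, 41, 68), (25, 42, 69), (25, 45, 65), (25, 46, 76),
    (26, 32, 68), (26, 33, 70), (26, 34, 71), (26, 35, 69), (26, 36, 73), (26, 37, 79),
    (26, 41, 64), (26, 42, 66), (26, 45, 77), (26, 47, 76), (27, 32, 76), (27, 33, 74),
    (27, 34, 77), (27, 36, 64), (27, 39, 66), (27, 41, 72), (27, 43, 73), (27, 46, 68),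
    (28, 32, 74), (28, 33, 73), (28, 34, 78), (28, 37, 68), (28, 38, 70), (28, 42, 76),
    (28, 45, 64), (29, 35, 74), (29, 37, 78), (29, 39, 79), (29, 41, 77), (29, 43, 69),
    (29, 45, 71), (30, 39, 75), (30, 40, 65), (30, 42, 68), (30, 44, 79), (30, 45, 74),
    (31, 35, 76), (31, 42, 74), (31, 43, 67), (31, 44, 70), (31, 46, 73), (31, 47, 78)]"

section \<open>Computations with the list of planes\<close>

lemma plane_points_code_planes:
  "list_all (\<lambda>t. distinct (plane_points t) \<and> list_all (\<lambda>p. 0 < p \<and> p < 128) (plane_points t)) code_planes"
  by code_simp

lemma distinct_code_planes: "distinct code_planes"
  by code_simp

lemma length_code_planes: "length code_planes = 330"
  by (simp add: code_planes_def)

text \<open>The smallest and the middle point determine a line, so a line in two planes would give a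
  repeated entry. Grouping by smallest point avoids comparing all pairs of planes.\<close>

lemma distinct_lines_at:
  "list_all (\<lambda>p. distinct (concat (map (lines_at p) code_planes))) [1..127]"
  by code_simp

lemma plane_points_bounds:
  assumes "t \<in> set code_planes"
  shows "distinct (plane_points t)" "set (plane_points t) \<subseteq> {0<..<128}"
  using plane_points_code_planes assms by (auto simp: list_all_iff simp del: plane_points.simps)

text \<open>Zero and seven distinct points make \<open>2 ^ 3\<close> vectors.\<close>

lemma dim_plane:
  assumes "t \<in> set code_planes"
  shows "vec.dim (plane t) = 3"
proof -
  have "inj_on vec_of (set (0 # plane_points t))"
    by (rule inj_on_subset[OF inj_vec_of]) (use plane_points_bounds(2)[OF assms] in auto)
  then have "card (plane t) = card (set (0 # plane_points t))"
    unfolding plane_eq by (rule card_image)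
  also have "\<dots> = length (0 # plane_points t)"
    by (rule distinct_card) (use plane_points_bounds[OF assms] in auto)
  also have "\<dots> = 2 ^ 3" by (cases t) simp
  finally have "(2 :: nat) ^ vec.dim (plane t) = 2 ^ 3"
    using card_subspace_bit[OF subspace_plane, of t] by simp
  then show ?thesis by (subst (asm) power_inject_exp) simp_all
qed

text \<open>Two common points would put the whole line through them into both planes, and its middle
  point would be recorded twice.\<close>

lemma plane_points_Int:
  assumes s: "s \<in> set code_planes" and t: "t \<in> set code_planes" and "s \<noteq> t"
    and p: "p \<in> set (plane_points s)" "p \<in> set (plane_points t)"
    and q: "q \<in> set (plane_points s)" "q \<in> set (plane_points t)"
  shows "p = q"
proof (rule ccontr)
  assume "p \<noteq> q"
  have "p \<noteq> 0" "q \<noteq> 0"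
    using plane_points_bounds(2)[OF s] p(1) q(1) by auto
  then obtain u v where uv: "u < v" "v < xor u v" "{u, v} \<subseteq> {p, q, xor p q}"
    using ordered_line \<open>p \<noteq> q\<close> by blast
  then have in_s: "u \<in> set (plane_points s)" "v \<in> set (plane_points s)"
    and in_t: "u \<in> set (plane_points t)" "v \<in> set (plane_points t)"
    using p q plane_points_xor[OF p(1) q(1) \<open>p \<noteq> q\<close>] plane_points_xor[OF p(2) q(2) \<open>p \<noteq> q\<close>]
    by blast+
  have "u \<in> {1..127}"
    using plane_points_bounds(2)[OF s] in_s by auto
  then have "distinct (concat (map (lines_at u) code_planes))"
    using distinct_lines_at by (simp add: list_all_iff)
  then have "set (lines_at u s) \<inter> set (lines_at u t) = {}"
    using s t \<open>s \<noteq> t\<close> by (rule disjoint_if_distinct_concat)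
  moreover have "v \<in> set (lines_at u s)" "v \<in> set (lines_at u t)"
    using in_s in_t uv by (simp_all add: lines_at_def)
  ultimately show False by blast
qed

text \<open>At most one common nonzero vector leaves at most two vectors in the
  intersection.\<close>

lemma dim_plane_Int:
  assumes s: "s \<in> set code_planes" and t: "t \<in> set code_planes" and "s \<noteq> t"
  shows "vec.dim (plane s \<inter> plane t) \<le> 1"
proof -
  let ?S = "set (plane_points s)" and ?T = "set (plane_points t)"
  have "plane s \<inter> plane t = vec_of ` (insert 0 ?S \<inter> insert 0 ?T)"
    unfolding plane_eq list.set
    by (rule inj_on_image_Int[OF inj_vec_of, symmetric])
      (use plane_points_bounds(2)[OF s] plane_points_bounds(2)[OF t] in auto)
  also have "insert 0 ?S \<inter> insert 0 ?T = insert 0 (?S \<inter> ?T)"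
    by auto
  finally have "card (plane s \<inter> plane t) \<le> card (insert 0 (?S \<inter> ?T))"
    by (metis card_image_le finite_Int finite_insert finite_set)
  also have "card (?S \<inter> ?T) \<le> 1"
    using plane_points_Int[OF assms] by (simp add: card_le_Suc0_iff_eq)
  then have "card (insert 0 (?S \<inter> ?T)) \<le> 2 ^ 1"
    by (simp add: card_insert_if)
  finally have "(2 :: nat) ^ vec.dim (plane s \<inter> plane t) \<le> 2 ^ 1"
    by (simp add: card_subspace_bit vec.subspace_inter subspace_plane)
  then show ?thesis by (subst (asm) power_increasing_iff) simp_all
qed

text \<open>Coinciding planes would meet in dimension 3. Hence the 330 triples give 330
  codewords.\<close>

lemma inj_on_plane: "inj_on plane (set code_planes)"
proof (rule inj_onI, rule ccontr)
  fix s t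
  assume st: "s \<in> set code_planes" "t \<in> set code_planes" "plane s = plane t" "s \<noteq> t"
  then show False using dim_plane_Int[of s t] dim_plane[of t] by simp
qed

lemma subspace_code_planes: "subspace_code_F2_7 4 (plane ` set code_planes)"
proof -
  have "4 \<le> subspace_dist (plane s) (plane t)"
    if st: "s \<in> set code_planes" "t \<in> set code_planes" and "plane s \<noteq> plane t" for s t
  proof -
    have "s \<noteq> t" using that by auto
    \<comment> \<open>The distance is \<open>3 + 3 - 2 * d\<close>, where the dimension
      \<open>d\<close> of the intersection is at most 1.\<close>
    then show ?thesis
      using dim_sum_Int[OF subspace_plane subspace_plane, of s t] dim_plane_Int[OF st]
        dim_plane[OF st(1)] dim_plane[OF st(2)]
      by (simp add: subspace_dist_def)
  qed
  then show ?thesis by (auto simp: subspace_code_F2_7_def subspace_plane)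
qed

theorem mainTheorem14:
  shows "330 \<le> A2_7 4 \<and> A2_7 4 \<le> 407"
proof -
  let ?N = "{card C | C. subspace_code_F2_7 4 C}"
  \<comment> \<open>\<open>Max\<close> is meaningful only on a finite nonempty set;
    \<open>mem\<close> below gives nonemptiness.\<close>
  have fin: "finite ?N" by simp
  have "card (plane ` set code_planes) = 330"
    by (simp add: card_image[OF inj_on_plane] distinct_card[OF distinct_code_planes] length_code_planes)
  then have mem: "330 \<in> ?N" using subspace_code_planes by force
  \<comment> \<open>The bound 404 of \<open>card_code_le\<close> is stronger than what is asked for
    here.\<close>
  have "n \<le> 407" if "n \<in> ?N" for n
    using that card_code_le by fastforce
  then have "Max ?N \<le> 407" using fin mem by (subst Max_le_iff) auto
  moreover have "330 \<le> Max ?N" using fin mem by (rule Max_ge)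
  ultimately show ?thesis by (simp add: A2_7_def)
qed

end
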